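(* Let $\bar\kappa$ be a Markov kernel on $\Omega=[0,1]$ (the kernel of the original MC) with stationary distribution $p\in\mathbf{D}$, satisfying Uniformly Bounded Variation, C\`adl\`ag and Countable Jump Discontinuities, and Unique Stationary Distribution. Let a sequence, indexed by $r\in\mathbb{N}$, of finite-state Markov chains with states $0=c^{(r)}_1<\dots<c^{(r)}_{J^{(r)}}=1$, transition matrices $Q^{(r)}=\{q^{(r)}_{ij}\}$ and stationary distributions (distribution functions) $p^{(r)}\in\mathbf{D}$ satisfy Proper Truncation with respect to $\bar\kappa$. Assume the states $\{c^{(r)}_i: i=1,\dots,J^{(r)},\,r\in\mathbb{N}\}$ are dense in $\Omega$ and $\max_{i=2,\dots,J^{(r)}}|c^{(r)}_i-c^{(r)}_{i-1}|=O(1/J^{(r)})$. Assume further that (i) $\bar\kappa$ is Lipschitz continuous on $(x,u)\in\Omega^2$, and (ii) there exists an interval $[x_1,x_2]\subseteq\Omega$, $x_1<x_2$, on which $p$ is continuous and strictly increasing. Let $\{\hat p^{(r)}\}_{r\in\mathbb{N}}\subseteq\mathbf{D}$ be any other sequence of discrete distributions, $\hat p^{(r)}$ having $\hat J^{(r)}$ jumps, with $$\lim_{r\to\infty}\frac{\hat J^{(r)}}{J^{(r)}}=1,$$ i.e. $\{p^{(r)}\}$ (counted as having $J^{(r)}$ jumps, one for each state) and $\{\hat p^{(r)}\}$ have asymptotically the same number of jumps. Then $$\|p^{(r)}-p\|_\infty=O\big(\|\hat p^{(r)}-p\|_\infty\big).$$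
   Context: Spaces. $\Omega=[0,1]$, $\mathcal{B}$ its Borel $\sigma$-algebra. $\mathbf{D}$ is the set of (right-continuous) distribution functions of probability measures on $(\Omega,\mathcal{B})$, viewed as functions on $\mathbb{R}$ that vanish for $x<0$ and are constant on $[1,\infty)$. $\mathbf{X}=\mathrm{span}(\mathbf{D})$ (distribution functions of finite signed measures on $\Omega$), and $\bar{\mathbf{X}}$ is its closure under the supremum norm $\|\cdot\|_\infty$. For $f\in\mathbf{X}$, $\int_\Omega g\,df$ is the integral against the signed measure with distribution function $f$ (including a possible atom at $0$). A discrete distribution with $\hat J$ jumps is the distribution function of a probability measure supported on $\hat J$ points. Kernels. A Markov kernel is $\bar\kappa:\Omega^2\to\mathbb{R}_+$ with $\bar\kappa(x,\cdot)$ $\mathcal{B}$-measurable for each $x$ and $\bar\kappa(\cdot,u)\in\mathbf{D}$ for each $u$. For $f\in\bar{\mathbf{X}}\setminus\mathbf{X}$, $\int_\Omega\bar\kappa(x,u)\,df(u)$ means $\lim_k\int_\Omega\bar\kappa(x,u)\,df_k(u)$ for any $(f_k)\subseteq\mathbf{X}$ converging to $f$ in $\|\cdot\|_\infty$ (well defined under Uniformly Bounded Variation). $V_u(\cdot)$ denotes total variation over $\Omega$ in the variable $u$. A stationary distribution of $\bar\kappa$ is $p\in\mathbf{D}$ with $p(x)=\int_\Omega\bar\kappa(x,u)\,dp(u)$ for all $x\in\Omega$. Put $c^{(r)}_0:=-\infty$, $c^{(r)}_{J^{(r)}+1}:=+\infty$, $\bar\kappa(-\infty,u):=0$, $\bar\omega^{(r)}_i(x):=\sum_{j=1}^{J^{(r)}}\mathbf{1}\{c^{(r)}_j\le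 x\}q^{(r)}_{ij}$ and $\bar\kappa^{(r)}(x,u):=\sum_{i=1}^{J^{(r)}}\bar\omega^{(r)}_i(x)\mathbf{1}\{u\in(c^{(r)}_{i-1},c^{(r)}_i]\}$. Let $\zeta_{\bar\kappa}(x_1,x_2):=|\bar\kappa(x_2,1)-\bar\kappa(x_1,1)|$ and $v_{\bar\kappa}(x_1,x_2):=V_u(\bar\kappa(x_2,u)-\bar\kappa(x_1,u))$. Conditions. Uniformly Bounded Variation: $\sup_{x\in\Omega}V_u(\bar\kappa(x,u))<\infty$. C\`adl\`ag and Countable Jump Discontinuities: for every $\epsilon>0$ there are knots $0=s_1<\dots<s_{N_\epsilon}=1$ such that, with $E_i=[s_i,s_{i+1})$ for $i<N_\epsilon$ and $E_{N_\epsilon}=\{1\}$, one has $\zeta_{\bar\kappa}(x_1,x_2)<\epsilon$ and $v_{\bar\kappa}(x_1,x_2)<\epsilon$ for all $x_1,x_2\in E_i$ and all $i$. Unique Stationary Distribution: the stationary distribution $p$ of $\bar\kappa$ is unique and the set of solutions $f\in\bar{\mathbf{X}}$ of $f(x)=\int_\Omega\bar\kappa(x,u)\,df(u)$ ($x\in\Omega$) is $\{\alpha p\}_{\alpha\in\mathbb{R}}$. Proper Truncation: (i) there are $\epsilon^{(r)}\in\mathbb{R}_+$ with $\lim_{r\to\infty}\epsilon^{(r)}=0$ such that for all $r$, all $i=1,\dots,J^{(r)}$ and all $x_1,x_2\in[c^{(r)}_i,c^{(r)}_{i+1})\cap\Omega$, $\zeta_{\bar\kappa}(x_1,x_2)<\epsilon^{(r)}$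 and $v_{\bar\kappa}(x_1,x_2)<\epsilon^{(r)}$; (ii) $\{c^{(r_1)}_i\}_{i}\subseteq\{c^{(r_2)}_i\}_{i}$ for all $r_1<r_2$; (iii) $q^{(r)}_{ij}=\bar\kappa(c^{(r)}_j,c^{(r)}_i)-\bar\kappa(c^{(r)}_{j-1},c^{(r)}_i)$ for all $i,j=1,\dots,J^{(r)}$, $r\in\mathbb{N}$; (iv) $\lim_{r\to\infty}\bar\kappa^{(r)}(x,u)=\bar\kappa(x,u)$ for all $x,u\in\Omega$. *)

theory Defs
  imports "HOL-Probability.Probability" "HOL-Library.Landau_Symbols"
begin

section \<open>Distribution functions on the unit interval\<close>

abbreviation unit_int :: "real set" where
  "unit_int \<equiv> {0..1}"

text \<open>
  Measures on \<open>unit_int\<close> are represented by Borel measures on the real line that vanish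
  off \<open>unit_int\<close>, so that their distribution functions are defined on all of the real line.
\<close>

definition concentrated_on_unit :: "real measure \<Rightarrow> bool" where
  "concentrated_on_unit M \<longleftrightarrow> emeasure M (UNIV - unit_int) = 0"

definition dist_funs :: "(real \<Rightarrow> real) set" where
  "dist_funs = {cdf M | M. real_distribution M \<and> concentrated_on_unit M}"

text \<open>The linear span of \<open>dist_funs\<close>.\<close>

definition span_dist_funs :: "(real \<Rightarrow> real) set" where
  "span_dist_funs =
    {(\<lambda>x. \<Sum>i<n. a i * F i x) | (n::nat) a F. \<forall>i<n. F i \<in> dist_funs}"

text \<open>
  The closure in the supremum norm.  The relation \<open>uniform_limit UNIV\<close> is convergence in
  that norm, and it does not presuppose that the limit is bounded.
\<close>

definition closure_span :: "(real \<Rightarrow> real) set" where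
  "closure_span =
    {f. \<exists>fs. (\<forall>k::nat. fs k \<in> span_dist_funs) \<and> uniform_limit UNIV fs f sequentially}"

definition sup_norm :: "(real \<Rightarrow> real) \<Rightarrow> real" where
  "sup_norm f = (SUP x. \<bar>f x\<bar>)"

text \<open>
  A discrete distribution function with \<open>n\<close> jumps: the measure lives on a set of \<open>n\<close> points.
  A point of that set may have mass zero; this is the same way of counting under which a
  finite chain has one jump for each of its states.
\<close>

definition discrete_dist :: "nat \<Rightarrow> (real \<Rightarrow> real) \<Rightarrow> bool" where
  "discrete_dist n F \<longleftrightarrow>
    (\<exists>M S. real_distribution M \<and> concentrated_on_unit M \<and> F = cdf M \<and>
       finite S \<and> S \<subseteq> unit_int \<and> card S = n \<and> measure M S = 1)"


section \<open>Integration against elements of the closed span\<close>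

text \<open>
  The signed measure with distribution function \<open>f\<close> is written as a difference of two finite
  measures.  For bounded measurable \<open>g\<close> the value does not depend on the choice of the two
  measures.  Mass at \<open>0\<close> is included, because \<open>cdf M 0\<close> is the measure of \<open>{..0}\<close>.
\<close>

definition represents_signed ::
    "real measure \<Rightarrow> real measure \<Rightarrow> (real \<Rightarrow> real) \<Rightarrow> bool" where
  "represents_signed M N f \<longleftrightarrow>
     finite_borel_measure M \<and> concentrated_on_unit M \<and>
     finite_borel_measure N \<and> concentrated_on_unit N \<and>
     f = (\<lambda>x. cdf M x - cdf N x)"

definition signed_integral :: "(real \<Rightarrow> real) \<Rightarrow> (real \<Rightarrow> real) \<Rightarrow> real" where
  "signed_integral g f =
    (THE I. \<exists>M N. represents_signed M N f \<and>
       I = (LINT u:unit_int|M. g u) - (LINT u:unit_int|N. g u))"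

text \<open>Off the span itself the integral is defined by approximation in the supremum norm.\<close>

definition ext_integral :: "(real \<Rightarrow> real) \<Rightarrow> (real \<Rightarrow> real) \<Rightarrow> real" where
  "ext_integral g f =
    (if f \<in> span_dist_funs then signed_integral g f
     else (THE L. \<forall>fs. (\<forall>k::nat. fs k \<in> span_dist_funs) \<and> uniform_limit UNIV fs f sequentially
                    \<longrightarrow> (\<lambda>k. signed_integral g (fs k)) \<longlonglongrightarrow> L))"


section \<open>Kernels\<close>

definition total_variation :: "(real \<Rightarrow> real) \<Rightarrow> ennreal" where
  "total_variation g =
    (SUP (n, t) \<in> {(n::nat, t::nat \<Rightarrow> real).
         t 0 = 0 \<and> t n = 1 \<and> (\<forall>i<n. t i \<le> t (Suc i))}.
       \<Sum>i<n. ennreal \<bar>g (t (Suc i)) - g (t i)\<bar>)"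

text \<open>
  Kernels are curried: in \<open>K x u\<close> the current state is \<open>u\<close>, and \<open>\<lambda>x. K x u\<close> is the distribution
  function of the next state.  Since it lies in \<open>dist_funs\<close>, \<open>K x u\<close> is determined for
  \<open>x\<close> off \<open>unit_int\<close> as well; the values for \<open>u\<close> off \<open>unit_int\<close> are irrelevant.
\<close>

definition markov_kernel :: "(real \<Rightarrow> real \<Rightarrow> real) \<Rightarrow> bool" where
  "markov_kernel K \<longleftrightarrow>
     (\<forall>x\<in>unit_int. \<forall>u\<in>unit_int. 0 \<le> K x u) \<and>
     (\<forall>x\<in>unit_int. K x \<in> borel_measurable (restrict_space borel unit_int)) \<and>
     (\<forall>u\<in>unit_int. (\<lambda>x. K x u) \<in> dist_funs)"

definition stationary :: "(real \<Rightarrow> real \<Rightarrow> real) \<Rightarrow> (real \<Rightarrow> real) \<Rightarrow> bool" where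
  "stationary K p \<longleftrightarrow> p \<in> dist_funs \<and> (\<forall>x\<in>unit_int. p x = ext_integral (K x) p)"

definition kernel_zeta :: "(real \<Rightarrow> real \<Rightarrow> real) \<Rightarrow> real \<Rightarrow> real \<Rightarrow> real" where
  "kernel_zeta K x1 x2 = \<bar>K x2 1 - K x1 1\<bar>"

definition kernel_var :: "(real \<Rightarrow> real \<Rightarrow> real) \<Rightarrow> real \<Rightarrow> real \<Rightarrow> ennreal" where
  "kernel_var K x1 x2 = total_variation (\<lambda>u. K x2 u - K x1 u)"

definition uniformly_bounded_variation :: "(real \<Rightarrow> real \<Rightarrow> real) \<Rightarrow> bool" where
  "uniformly_bounded_variation K \<longleftrightarrow> (SUP x\<in>unit_int. total_variation (K x)) < \<infinity>"

definition cadlag_countable_jumps :: "(real \<Rightarrow> real \<Rightarrow> real) \<Rightarrow> bool" where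
  "cadlag_countable_jumps K \<longleftrightarrow>
    (\<forall>e>0. \<exists>(N::nat) s.
       1 \<le> N \<and> s 1 = 0 \<and> s N = 1 \<and> strict_mono_on {1..N} s \<and>
       (\<forall>i\<in>{1..N}. let E = (if i < N then {s i..<s (Suc i)} else {1}) in
          \<forall>x1\<in>E. \<forall>x2\<in>E. kernel_zeta K x1 x2 < e \<and> kernel_var K x1 x2 < ennreal e))"

definition unique_stationary :: "(real \<Rightarrow> real \<Rightarrow> real) \<Rightarrow> (real \<Rightarrow> real) \<Rightarrow> bool" where
  "unique_stationary K p \<longleftrightarrow>
     stationary K p \<and> (\<forall>p'. stationary K p' \<longrightarrow> p' = p) \<and>
     {f \<in> closure_span. \<forall>x\<in>unit_int. f x = ext_integral (K x) f} = {(\<lambda>x. \<alpha> * p x) | \<alpha>. True}"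


section \<open>Finite-state chains and truncation\<close>

text \<open>The states are \<open>c 1, \<dots>, c J\<close>, and \<open>Q i j\<close> is the transition probability from \<open>c i\<close> to \<open>c j\<close>.\<close>

definition finite_chain :: "nat \<Rightarrow> (nat \<Rightarrow> real) \<Rightarrow> (nat \<Rightarrow> nat \<Rightarrow> real) \<Rightarrow> bool" where
  "finite_chain J c Q \<longleftrightarrow>
     1 \<le> J \<and> c 1 = 0 \<and> c J = 1 \<and> strict_mono_on {1..J} c \<and>
     (\<forall>i\<in>{1..J}. (\<forall>j\<in>{1..J}. 0 \<le> Q i j) \<and> (\<Sum>j=1..J. Q i j) = 1)"

definition chain_stationary ::
    "nat \<Rightarrow> (nat \<Rightarrow> real) \<Rightarrow> (nat \<Rightarrow> nat \<Rightarrow> real) \<Rightarrow> (real \<Rightarrow> real) \<Rightarrow> bool" where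
  "chain_stationary J c Q F \<longleftrightarrow>
     F \<in> dist_funs \<and>
     (\<exists>w. (\<forall>i\<in>{1..J}. 0 \<le> w i) \<and> (\<Sum>i=1..J. w i) = 1 \<and>
        (\<forall>j\<in>{1..J}. w j = (\<Sum>i=1..J. w i * Q i j)) \<and>
        F = (\<lambda>x. \<Sum>j=1..J. of_bool (c j \<le> x) * w j))"

definition ext_state :: "nat \<Rightarrow> (nat \<Rightarrow> real) \<Rightarrow> nat \<Rightarrow> ereal" where
  "ext_state J c i = (if i = 0 then -\<infinity> else if i \<le> J then ereal (c i) else \<infinity>)"

text \<open>Only used at \<open>-\<infinity>\<close> and at finite points.\<close>

definition ext_kernel :: "(real \<Rightarrow> real \<Rightarrow> real) \<Rightarrow> ereal \<Rightarrow> real \<Rightarrow> real" where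
  "ext_kernel K y u = (if y = -\<infinity> then 0 else K (real_of_ereal y) u)"

definition trunc_weight ::
    "nat \<Rightarrow> (nat \<Rightarrow> real) \<Rightarrow> (nat \<Rightarrow> nat \<Rightarrow> real) \<Rightarrow> nat \<Rightarrow> real \<Rightarrow> real" where
  "trunc_weight J c Q i x = (\<Sum>j=1..J. of_bool (c j \<le> x) * Q i j)"

definition trunc_kernel ::
    "nat \<Rightarrow> (nat \<Rightarrow> real) \<Rightarrow> (nat \<Rightarrow> nat \<Rightarrow> real) \<Rightarrow> real \<Rightarrow> real \<Rightarrow> real" where
  "trunc_kernel J c Q x u =
    (\<Sum>i=1..J. trunc_weight J c Q i x *
       of_bool (ereal u \<in> {ext_state J c (i - 1)<..ext_state J c i}))"

definition proper_truncation ::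
    "(real \<Rightarrow> real \<Rightarrow> real) \<Rightarrow> (nat \<Rightarrow> nat) \<Rightarrow> (nat \<Rightarrow> nat \<Rightarrow> real) \<Rightarrow>
     (nat \<Rightarrow> nat \<Rightarrow> nat \<Rightarrow> real) \<Rightarrow> bool" where
  "proper_truncation K J c Q \<longleftrightarrow>
     (\<exists>e::nat \<Rightarrow> real. (\<forall>r. 0 \<le> e r) \<and> e \<longlonglongrightarrow> 0 \<and>
        (\<forall>r. \<forall>i\<in>{1..J r}.
           let E = {x \<in> unit_int. ext_state (J r) (c r) i \<le> ereal x \<and>
                                  ereal x < ext_state (J r) (c r) (Suc i)} in
           \<forall>x1\<in>E. \<forall>x2\<in>E. kernel_zeta K x1 x2 < e r \<and> kernel_var K x1 x2 < ennreal (e r))) \<and>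
     (\<forall>r1 r2. r1 < r2 \<longrightarrow> c r1 ` {1..J r1} \<subseteq> c r2 ` {1..J r2}) \<and>
     (\<forall>r. \<forall>i\<in>{1..J r}. \<forall>j\<in>{1..J r}.
        Q r i j = ext_kernel K (ext_state (J r) (c r) j) (c r i)
                - ext_kernel K (ext_state (J r) (c r) (j - 1)) (c r i)) \<and>
     (\<forall>x\<in>unit_int. \<forall>u\<in>unit_int. (\<lambda>r. trunc_kernel (J r) (c r) (Q r) x u) \<longlonglongrightarrow> K x u)"

end

theory Submission
  imports Defs "HOL-Complex_Analysis.Great_Picard"
begin

text \<open>
  Write \<open>T f\<close> for \<open>\<lambda>x. \<integral> K x df\<close>.  Since \<open>p = T p\<close>, the difference \<open>f = pr - p\<close> satisfies
  \<open>f - T f = pr - T pr\<close>, and by Lipschitz continuity of the kernel this is at most a multiple of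
  the mesh, hence \<open>O(1/J)\<close>.  The operator \<open>T\<close> is compact for the supremum norm and has no nonzero
  fixed point with \<open>f 1 = 0\<close>, so \<open>f\<close> itself is \<open>O(1/J)\<close>.  Conversely a discrete distribution with
  \<open>n\<close> jumps has distance at least a multiple of \<open>1/(n + 1)\<close> from \<open>p\<close>, because \<open>p\<close> increases
  continuously on an interval.

  Since the kernel is continuous in \<open>u\<close>, the integral against a signed measure is a limit of
  Riemann--Stieltjes sums; this gives its independence of the chosen measures, its linearity,
  and its bound by the supremum norm of the distribution function.
\<close>

section \<open>Distribution functions of signed measures\<close>

lemma cdf_concentrated:
  assumes "finite_borel_measure M" "concentrated_on_unit M"
  shows cdf_eq_0_below_unit: "x < 0 \<Longrightarrow> cdf M x = 0"
    and cdf_const_above_unit: "1 \<le> x \<Longrightarrow> cdf M x = measure M UNIV"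
    and measure_singleton_0_eq_cdf: "measure M {0} = cdf M 0"
proof -
  interpret finite_borel_measure M by fact
  have null: "UNIV - unit_int \<in> null_sets M"
    using assms(2) by (auto simp: concentrated_on_unit_def M_is_borel)
  show "cdf M x = 0" if "x < 0"
    unfolding cdf_def
    by (rule measure_eq_0_null_sets, rule null_sets_subset[OF null]) (use that in \<open>auto simp: M_is_borel\<close>)
  \<comment> \<open>Sets that differ only off the unit interval have equal mass. This is used for
    \<open>{..x}\<close> against \<open>UNIV\<close> and for \<open>{0}\<close> against
    \<open>{..0}\<close>.\<close>
  have *: "measure M A = measure M B"
    if "A \<subseteq> B" "B - A \<subseteq> UNIV - unit_int" "A \<in> sets borel" "B \<in> sets borel" for A B
  proof -
    have "measure M (B - A) = 0"
      by (rule measure_eq_0_null_sets, rule null_sets_subset[OF null]) (use that in \<open>auto simp: M_is_borel\<close>)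
    then show ?thesis
      using finite_measure_Diff[of B A] that by (auto simp: M_is_borel)
  qed
  show "cdf M x = measure M UNIV" if "1 \<le> x"
    unfolding cdf_def by (rule *) (use that in auto)
  show "measure M {0} = cdf M 0"
    unfolding cdf_def by (rule *) auto
qed

lemma dist_funsE:
  assumes "F \<in> dist_funs"
  obtains M where "real_distribution M" "finite_borel_measure M" "concentrated_on_unit M" "F = cdf M"
  using assms real_distribution.finite_borel_measure_M by (auto simp: dist_funs_def)

lemma dist_funs_properties:
  assumes "F \<in> dist_funs"
  shows dist_funs_below: "x < 0 \<Longrightarrow> F x = 0"
    and dist_funs_above: "1 \<le> x \<Longrightarrow> F x = 1"
    and dist_funs_nonneg: "0 \<le> F x"
    and dist_funs_le_1: "F x \<le> 1"
    and dist_funs_mono: "x \<le> y \<Longrightarrow> F x \<le> F y"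
    and dist_funs_right_cont: "continuous (at_right x) F"
proof -
  obtain M where M: "real_distribution M" "finite_borel_measure M" "concentrated_on_unit M" "F = cdf M"
    by (rule dist_funsE[OF assms])
  interpret real_distribution M by fact
  show "x < 0 \<Longrightarrow> F x = 0" "1 \<le> x \<Longrightarrow> F x = 1" "0 \<le> F x" "F x \<le> 1" "x \<le> y \<Longrightarrow> F x \<le> F y"
    "continuous (at_right x) F"
    using cdf_eq_0_below_unit[OF M(2,3)] cdf_const_above_unit[OF M(2,3)] M(4) prob_space
    by (auto simp: cdf_nonneg cdf_bounded_prob cdf_nondecreasing cdf_is_right_cont)
qed

lemma dist_funs_subset_span: "F \<in> dist_funs \<Longrightarrow> F \<in> span_dist_funs"
  unfolding span_dist_funs_def
  by (auto intro!: exI[of _ "1::nat"] exI[of _ "\<lambda>_. 1::real"] exI[of _ "\<lambda>_. F"])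

lemma span_dist_funs_scale:
  assumes "f \<in> span_dist_funs" shows "(\<lambda>x. b * f x) \<in> span_dist_funs"
proof -
  obtain n a F where "f = (\<lambda>x. \<Sum>i<n. a i * F i x)" "\<forall>i<n::nat. F i \<in> dist_funs"
    using assms by (auto simp: span_dist_funs_def)
  then show ?thesis
    unfolding span_dist_funs_def
    by (auto intro!: exI[of _ n] exI[of _ "\<lambda>i. b * a i"] exI[of _ F] simp: sum_distrib_left mult.assoc)
qed

lemma span_dist_funs_diff:
  assumes "F \<in> dist_funs" "G \<in> dist_funs" shows "(\<lambda>x. F x - G x) \<in> span_dist_funs"
  unfolding span_dist_funs_def using assms
  by (auto intro!: exI[of _ "2::nat"] exI[of _ "\<lambda>i. if i = 0 then 1 else - 1::real"]
      exI[of _ "\<lambda>i. if i = 0 then F else G"] simp: numeral_2_eq_2 less_Suc_eq)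

lemma span_dist_funs_properties:
  assumes "f \<in> span_dist_funs"
  shows span_dist_funs_below: "x < 0 \<Longrightarrow> f x = 0"
    and span_dist_funs_above: "1 \<le> x \<Longrightarrow> f x = f 1"
    and span_dist_funs_bounded: "\<exists>B. \<forall>x. \<bar>f x\<bar> \<le> B"
proof -
  obtain n a F where f: "f = (\<lambda>x. \<Sum>i<n. a i * F i x)" and F: "\<forall>i<n::nat. F i \<in> dist_funs"
    using assms by (auto simp: span_dist_funs_def)
  show "x < 0 \<Longrightarrow> f x = 0"
    using F by (auto simp: f dist_funs_below intro!: sum.neutral)
  show "1 \<le> x \<Longrightarrow> f x = f 1"
    using F by (auto simp: f dist_funs_above intro!: sum.cong)
  have "\<bar>f x\<bar> \<le> (\<Sum>i<n. \<bar>a i\<bar>)" for x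
    unfolding f using F
    by (intro order_trans[OF sum_abs] sum_mono)
      (auto simp: abs_mult dist_funs_nonneg dist_funs_le_1 intro!: mult_left_le)
  then show "\<exists>B. \<forall>x. \<bar>f x\<bar> \<le> B" by blast
qed

text \<open>With nonnegative coefficients the combination is itself nondecreasing and
  right-continuous, so its Lebesgue-Stieltjes measure serves and no measures have to be
  added.\<close>

lemma nonneg_combination_measure:
  fixes n :: nat
  assumes F: "\<And>i. i < n \<Longrightarrow> F i \<in> dist_funs" and a: "\<And>i. i < n \<Longrightarrow> 0 \<le> a i"
  obtains M where "finite_borel_measure M" "concentrated_on_unit M"
    "cdf M = (\<lambda>x. \<Sum>i<n. a i * F i x)"
proof -
  define G where "G = (\<lambda>x. \<Sum>i<n. a i * F i x)"
  have mono: "G x \<le> G y" if "x \<le> y" for x y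
    unfolding G_def
    by (rule sum_mono) (simp add: F a that dist_funs_mono mult_left_mono)
  have rc: "continuous (at_right x) G" for x
    unfolding G_def by (intro continuous_sum continuous_mult_left dist_funs_right_cont F) simp
  have below: "G x = 0" if "x < 0" for x
    unfolding G_def by (simp add: dist_funs_below[OF F that])
  have above: "G x = G 1" if "1 \<le> x" for x
    unfolding G_def by (simp add: dist_funs_above[OF F] that)
  have bot: "(G \<longlongrightarrow> 0) at_bot"
    using below by (intro tendsto_eventually) (auto simp: eventually_at_bot_dense)
  have top: "(G \<longlongrightarrow> G 1) at_top"
    by (intro tendsto_eventually eventually_at_top_linorderI above)
  have "0 \<le> G 1" using below[of "-1"] mono[of "-1" 1] by simp
  then have fin: "finite_borel_measure (interval_measure G)"
    by (intro finite_borel_measure_interval_measure[OF mono rc bot top])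
  have cdf: "cdf (interval_measure G) = (\<lambda>x. \<Sum>i<n. a i * F i x)"
    using cdf_interval_measure[OF mono rc bot] by (simp add: G_def)
  interpret finite_borel_measure "interval_measure G" by fact
  let ?M = "interval_measure G"
  have U: "emeasure ?M UNIV = G 1"
    by (rule interval_measure_UNIV[OF mono rc bot top \<open>0 \<le> G 1\<close>])
  have "measure ?M {..<0} = 0"
  proof (rule tendsto_unique[OF _ cdf_at_left])
    show "(cdf ?M \<longlongrightarrow> 0) (at_left 0)"
      using below by (intro tendsto_eventually) (simp add: cdf G_def[symmetric] eventually_at_filter)
  qed simp
  moreover have "measure ?M {1<..} = 0"
  proof -
    have "measure ?M (UNIV - {..1}) = measure ?M UNIV - measure ?M {..1}"
      using finite_measure_compl[of "{..1}"] by simp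
    also have "\<dots> = 0"
      using U \<open>0 \<le> G 1\<close> measure_interval_measure_Iic[OF mono rc bot, of 1]
      by (simp add: measure_def)
    also have "UNIV - {..1} = {1::real<..}" by auto
    finally show ?thesis .
  qed
  ultimately have "emeasure ?M ({..<0} \<union> {1<..}) = 0"
    by (subst plus_emeasure[symmetric]) (auto simp: emeasure_eq_measure)
  also have "{..<0} \<union> {1<..} = UNIV - unit_int" by auto
  finally have "concentrated_on_unit ?M" by (simp add: concentrated_on_unit_def)
  with fin cdf show thesis by (intro that)
qed

text \<open>Positive and negative coefficients are collected in two separate measures. This is the
  existence half of the well-definedness of \<open>signed_integral\<close>.\<close>

lemma span_dist_funs_represents:
  assumes "f \<in> span_dist_funs"
  obtains M N where "represents_signed M N f"
proof -
  obtain n :: nat and a :: "nat \<Rightarrow> real" and F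
    where f: "f = (\<lambda>x. \<Sum>i<n. a i * F i x)" and F: "\<And>i. i < n \<Longrightarrow> F i \<in> dist_funs"
    using assms unfolding span_dist_funs_def mem_Collect_eq by metis
  obtain M where "finite_borel_measure M" "concentrated_on_unit M"
    and M: "cdf M = (\<lambda>x. \<Sum>i<n. max 0 (a i) * F i x)"
    by (rule nonneg_combination_measure[of n F "\<lambda>i. max 0 (a i)"]) (auto intro: F)
  moreover obtain N where "finite_borel_measure N" "concentrated_on_unit N"
    and N: "cdf N = (\<lambda>x. \<Sum>i<n. max 0 (- a i) * F i x)"
    by (rule nonneg_combination_measure[of n F "\<lambda>i. max 0 (- a i)"]) (auto intro: F)
  moreover have "f = (\<lambda>x. cdf M x - cdf N x)"
    unfolding f M N sum_subtractf[symmetric] left_diff_distrib[symmetric]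
    by (intro ext sum.cong) auto
  ultimately have "represents_signed M N f" unfolding represents_signed_def by (intro conjI)
  then show thesis by (rule that)
qed

section \<open>Riemann--Stieltjes sums\<close>

text \<open>The first summand accounts for an atom at \<open>0\<close>.\<close>

definition rs_sum :: "(real \<Rightarrow> real) \<Rightarrow> (real \<Rightarrow> real) \<Rightarrow> nat \<Rightarrow> real" where
  "rs_sum g f n = g 0 * f 0 +
     (\<Sum>i<n. g (real (Suc i) / real n) * (f (real (Suc i) / real n) - f (real i / real n)))"

lemma rs_sum_linear:
  shows rs_sum_diff_right: "rs_sum g (\<lambda>x. f x - h x) n = rs_sum g f n - rs_sum g h n"
    and rs_sum_scale_right: "rs_sum g (\<lambda>x. b * f x) n = b * rs_sum g f n"
    and rs_sum_diff_left: "rs_sum (\<lambda>u. g u - k u) f n = rs_sum g f n - rs_sum k f n"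
    and rs_sum_sum_right: "finite A \<Longrightarrow> rs_sum g (\<lambda>x. \<Sum>j\<in>A. H j x) n = (\<Sum>j\<in>A. rs_sum g (H j) n)"
proof -
  show "rs_sum g (\<lambda>x. f x - h x) n = rs_sum g f n - rs_sum g h n"
    "rs_sum g (\<lambda>x. b * f x) n = b * rs_sum g f n"
    "rs_sum (\<lambda>u. g u - k u) f n = rs_sum g f n - rs_sum k f n"
    by (simp_all add: rs_sum_def sum_subtractf sum_distrib_left algebra_simps sum.distrib)
  show "rs_sum g (\<lambda>x. \<Sum>j\<in>A. H j x) n = (\<Sum>j\<in>A. rs_sum g (H j) n)" if "finite A"
    using that
    by (induction A)
      (simp_all add: rs_sum_def sum_subtractf sum.distrib algebra_simps)
qed

section \<open>Integrals as limits of Riemann-Stieltjes sums\<close>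

lemma continuous_set_integrable:
  fixes g :: "real \<Rightarrow> real"
  assumes "finite_borel_measure M" "continuous_on {a..b} g"
  shows "set_integrable M {a..b} g"
proof -
  interpret finite_borel_measure M by fact
  obtain B where B: "\<And>u. u \<in> {a..b} \<Longrightarrow> \<bar>g u\<bar> \<le> B"
    using compact_imp_bounded[OF compact_continuous_image[OF assms(2) compact_Icc]]
    unfolding bounded_iff by (metis imageI real_norm_def)
  have "(\<lambda>x. indicator {a..b} x *\<^sub>R g x) \<in> borel_measurable borel"
    using assms(2) by (intro borel_measurable_continuous_on_indicator) auto
  then have "(\<lambda>x. indicator {a..b} x *\<^sub>R g x) \<in> borel_measurable M"
    by (simp add: measurable_cong_sets[OF M_is_borel refl])
  then show ?thesis
    unfolding set_integrable_def
    by (rule integrable_const_bound[rotated, where B = "max 0 B"])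
      (auto simp: indicator_def intro!: AE_I2 order_trans[OF B])
qed

text \<open>By uniform continuity \<open>g\<close> is nearly equal to its right endpoint value on
  each cell of a fine grid, so the error is at most a small number times the total mass.\<close>

lemma rs_sum_tendsto_measure:
  assumes M: "finite_borel_measure M" "concentrated_on_unit M" and g: "continuous_on unit_int g"
  shows "rs_sum g (cdf M) \<longlonglongrightarrow> (LINT u:unit_int|M. g u)"
proof -
  interpret finite_borel_measure M by fact
  have si: "set_integrable M A g" if "A \<subseteq> unit_int" "A \<in> sets borel" for A
    by (rule set_integrable_subset[OF continuous_set_integrable[OF M(1) g]])
      (use that in \<open>auto simp: M_is_borel\<close>)
  have uc: "uniformly_continuous_on unit_int g"
    by (rule compact_uniformly_continuous[OF g]) simp
  show ?thesis
  proof (rule LIMSEQ_I)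
    fix e :: real assume "0 < e"
    define m where "m = measure M UNIV"
    have "0 \<le> m" by (simp add: m_def)
    \<comment> \<open>The summand 1 keeps the divisor positive for the zero measure and makes the
      final estimate strict.\<close>
    define e' where "e' = e / (m + 1)"
    have "0 < e'" using \<open>0 < e\<close> \<open>0 \<le> m\<close> by (simp add: e'_def)
    then obtain d where "0 < d"
      and d: "\<And>u v. \<lbrakk>u \<in> unit_int; v \<in> unit_int; dist v u < d\<rbrakk> \<Longrightarrow> dist (g v) (g u) < e'"
      using uc unfolding uniformly_continuous_on_def by metis
    obtain N where N: "1 / real (Suc N) < d" using \<open>0 < d\<close> by (rule nat_approx_posE)
    have "norm (rs_sum g (cdf M) n - (LINT u:unit_int|M. g u)) < e" if "Suc N \<le> n" for n
    proof -
      have n: "0 < n" "1 / real n < d"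
        using that N by (auto intro!: le_less_trans[OF _ N] simp: frac_le)
      define t where "t i = real i / real n" for i
      \<comment> \<open>Induction over the cells. The atom at 0 is integrated exactly, and each
        half-open cell contributes an error of at most \<open>e'\<close> times its mass.\<close>
      have "\<bar>g 0 * cdf M 0 + (\<Sum>i<k. g (t (Suc i)) * (cdf M (t (Suc i)) - cdf M (t i)))
          - (LINT u:{0..t k}|M. g u)\<bar> \<le> e' * (cdf M (t k) - cdf M 0)" if "k \<le> n" for k
        using that
      proof (induction k)
        case 0
        have "(LINT u:{0..0}|M. g u) = (LINT u:{0}|M. g 0)"
          unfolding set_lebesgue_integral_def
          by (rule Bochner_Integration.integral_cong) (auto simp: indicator_def)
        also have "\<dots> = g 0 * cdf M 0"
          by (subst set_integral_const) (auto simp: M_is_borel measure_singleton_0_eq_cdf[OF M])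
        finally show ?case by (simp add: t_def)
      next
        case (Suc k)
        have t: "0 \<le> t k" "t k < t (Suc k)" "t (Suc k) \<le> 1"
          using Suc.prems n by (auto simp: t_def field_simps)
        let ?I = "{t k<..t (Suc k)}"
        have sets: "?I \<in> sets M" by (auto simp: M_is_borel)
        have sub: "?I \<subseteq> unit_int" using t by auto
        have ms: "measure M ?I = cdf M (t (Suc k)) - cdf M (t k)"
          using cdf_diff_eq[OF t(2)] by simp
        have split: "(LINT u:{0..t (Suc k)}|M. g u) = (LINT u:{0..t k}|M. g u) + (LINT u:?I|M. g u)"
        proof -
          have "{0..t (Suc k)} = {0..t k} \<union> ?I" using t by auto
          then show ?thesis using t by (auto intro!: set_integral_Un si)
        qed
        have ci: "set_integrable M ?I (\<lambda>_. x)" for x :: real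
          unfolding set_integrable_def using sets
          by (intro integrable_scaleR_left integrable_real_indicator) (auto simp: emeasure_eq_measure)
        have close: "\<bar>g (t (Suc k)) - g u\<bar> \<le> e'" if "u \<in> ?I" for u
        proof -
          have "t (Suc k) - t k = 1 / real n" by (simp add: t_def diff_divide_distrib[symmetric])
          then have "dist (t (Suc k)) u < d" using that n(2) by (auto simp: dist_real_def)
          then show ?thesis using d[of u "t (Suc k)"] that t by (auto simp: dist_real_def)
        qed
        have "\<bar>g (t (Suc k)) * measure M ?I - (LINT u:?I|M. g u)\<bar>
            = \<bar>LINT u:?I|M. g (t (Suc k)) - g u\<bar>"
          using set_integral_diff(2)[OF ci si[OF sub]] sets
          by (simp add: set_integral_const mult.commute)
        also have "\<dots> \<le> (LINT u:?I|M. \<bar>g (t (Suc k)) - g u\<bar>)"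
          using set_integral_norm_bound[OF set_integral_diff(1)[OF ci si[OF sub]]] by simp
        also have "\<dots> \<le> (LINT u:?I|M. e')"
          by (rule set_integral_mono)
            (auto intro!: set_integrable_abs set_integral_diff(1) ci si sub close)
        also have "\<dots> = e' * measure M ?I"
          using sets by (simp add: set_integral_const mult.commute)
        finally have "\<bar>g (t (Suc k)) * measure M ?I - (LINT u:?I|M. g u)\<bar> \<le> e' * measure M ?I" .
        moreover have "e' * (cdf M (t (Suc k)) - cdf M 0)
            = e' * (cdf M (t k) - cdf M 0) + e' * measure M ?I"
          by (simp add: ms algebra_simps)
        ultimately show ?case
          using Suc.IH Suc.prems unfolding split by (simp add: ms[symmetric])
      qed
      from this[of n] n(1) have "\<bar>rs_sum g (cdf M) n - (LINT u:unit_int|M. g u)\<bar> \<le> e' * (cdf M 1 - cdf M 0)"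
        by (simp add: rs_sum_def t_def)
      also have "\<dots> \<le> e' * m"
        using \<open>0 < e'\<close> cdf_nonneg[of 0] cdf_bounded[of 1]
        by (intro mult_left_mono) (auto simp: m_def borel_UNIV)
      also have "\<dots> < e" using \<open>0 < e\<close> \<open>0 \<le> m\<close> by (simp add: e'_def field_simps)
      finally show ?thesis by simp
    qed
    then show "\<exists>no. \<forall>n\<ge>no. norm (rs_sum g (cdf M) n - (LINT u:unit_int|M. g u)) < e" by blast
  qed
qed

text \<open>The sums involve only \<open>f\<close>, not the measures representing it. Uniqueness of
  limits therefore forces all representations to give the same value, and the definite description
  is justified.\<close>

lemma rs_sum_tendsto_signed_integral:
  assumes f: "f \<in> span_dist_funs" and g: "continuous_on unit_int g"
  shows "rs_sum g f \<longlonglongrightarrow> signed_integral g f"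
proof -
  have lim: "rs_sum g f \<longlonglongrightarrow> (LINT u:unit_int|M. g u) - (LINT u:unit_int|N. g u)"
    if "represents_signed M N f" for M N
  proof -
    from that have "rs_sum g f = (\<lambda>n. rs_sum g (cdf M) n - rs_sum g (cdf N) n)"
      by (auto simp: represents_signed_def rs_sum_diff_right)
    with that show ?thesis
      by (auto simp: represents_signed_def intro!: tendsto_diff rs_sum_tendsto_measure g)
  qed
  obtain M N where MN: "represents_signed M N f" using span_dist_funs_represents[OF f] .
  have "signed_integral g f = (LINT u:unit_int|M. g u) - (LINT u:unit_int|N. g u)"
    unfolding signed_integral_def
    by (rule the_equality) (use MN lim LIMSEQ_unique in blast)+
  with lim[OF MN] show ?thesis by simp
qed

section \<open>Linearity and discrete integrators\<close>

lemma signed_integral_scale: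
  assumes "f \<in> span_dist_funs" "continuous_on unit_int g"
  shows "signed_integral g (\<lambda>x. b * f x) = b * signed_integral g f"
proof (rule LIMSEQ_unique[OF rs_sum_tendsto_signed_integral])
  show "rs_sum g (\<lambda>x. b * f x) \<longlonglongrightarrow> b * signed_integral g f"
    unfolding rs_sum_scale_right by (intro tendsto_intros rs_sum_tendsto_signed_integral assms)
qed (use assms in \<open>auto intro: span_dist_funs_scale\<close>)

lemma signed_integral_diff:
  assumes "F \<in> dist_funs" "G \<in> dist_funs" "continuous_on unit_int g"
  shows "signed_integral g (\<lambda>x. F x - G x) = signed_integral g F - signed_integral g G"
proof (rule LIMSEQ_unique[OF rs_sum_tendsto_signed_integral])
  show "rs_sum g (\<lambda>x. F x - G x) \<longlonglongrightarrow> signed_integral g F - signed_integral g G"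
    unfolding rs_sum_diff_right
    by (intro tendsto_intros rs_sum_tendsto_signed_integral dist_funs_subset_span assms)
qed (use assms in \<open>auto intro: span_dist_funs_diff\<close>)

text \<open>The unit step at \<open>c\<close> is the distribution function of the Dirac measure at
  \<open>c\<close>.\<close>

lemma rs_sum_tendsto_point:
  assumes "continuous_on unit_int g" "c \<in> unit_int"
  shows "rs_sum g (\<lambda>x. of_bool (c \<le> x)) \<longlonglongrightarrow> g c"
proof -
  have cdf: "cdf (return borel c) = (\<lambda>x. of_bool (c \<le> x))"
    by (auto simp: cdf_def measure_return indicator_def fun_eq_iff)
  interpret prob_space "return borel c" by (rule prob_space_return) simp
  have M: "finite_borel_measure (return borel c)" by standard simp
  have "concentrated_on_unit (return borel c)"
    using assms(2) by (simp add: concentrated_on_unit_def)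
  from rs_sum_tendsto_measure[OF M this assms(1)] 
  have "rs_sum g (\<lambda>x. of_bool (c \<le> x)) \<longlonglongrightarrow> (LINT u:unit_int|return borel c. g u)"
    unfolding cdf .
  also have "(LINT u:unit_int|return borel c. g u) = g c"
    unfolding set_lebesgue_integral_def
    using assms borel_measurable_continuous_on_indicator[of unit_int g]
    by (subst integral_return) auto
  finally show ?thesis .
qed

lemma signed_integral_discrete:
  assumes "continuous_on unit_int g" "finite A" "\<And>j. j \<in> A \<Longrightarrow> c j \<in> unit_int"
    and F: "F = (\<lambda>x. \<Sum>j\<in>A. of_bool (c j \<le> x) * w j)" "F \<in> span_dist_funs"
  shows "signed_integral g F = (\<Sum>j\<in>A. w j * g (c j))"
proof (rule LIMSEQ_unique[OF rs_sum_tendsto_signed_integral[OF F(2) assms(1)]])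
  have "rs_sum g F = (\<lambda>n. \<Sum>j\<in>A. w j * rs_sum g (\<lambda>x. of_bool (c j \<le> x)) n)"
    using assms(2)
    unfolding F(1) by (intro ext) (simp only: rs_sum_sum_right rs_sum_scale_right[symmetric] mult.commute)
  also have "\<dots> \<longlonglongrightarrow> (\<Sum>j\<in>A. w j * g (c j))"
    using assms by (intro tendsto_intros rs_sum_tendsto_point) auto
  finally show "rs_sum g F \<longlonglongrightarrow> (\<Sum>j\<in>A. w j * g (c j))" .
qed

text \<open>Summation by parts moves the increments from \<open>f\<close> to \<open>g\<close>.\<close>

lemma rs_sum_bound:
  assumes V: "total_variation g \<le> ennreal V" "0 \<le> V" and B: "\<And>x. x \<in> unit_int \<Longrightarrow> \<bar>f x\<bar> \<le> B"
    and n: "0 < n"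
  shows "\<bar>rs_sum g f n\<bar> \<le> (\<bar>g 1\<bar> + V) * B"
proof -
  define t where "t i = real i / real n" for i
  have t01: "t i \<in> unit_int" if "i \<le> n" for i using that n by (auto simp: t_def field_simps)
  have B0: "0 \<le> B" using B[of 0] by auto
  \<comment> \<open>The boundary term at 0 cancels against the atom term \<open>g 0 * f 0\<close> of
    \<open>rs_sum\<close>, so only the one at 1 survives.\<close>
  have "(\<Sum>i<k. g (t (Suc i)) * (f (t (Suc i)) - f (t i)))
      = g (t k) * f (t k) - g (t 0) * f (t 0) - (\<Sum>i<k. f (t i) * (g (t (Suc i)) - g (t i)))" for k
    by (induction k) (auto simp: algebra_simps)
  from this[of n] have eq: "rs_sum g f n = g 1 * f 1 - (\<Sum>i<n. f (t i) * (g (t (Suc i)) - g (t i)))"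
    using n by (simp add: rs_sum_def t_def)
  have "ennreal (\<Sum>i<n. \<bar>g (t (Suc i)) - g (t i)\<bar>) = (\<Sum>i<n. ennreal \<bar>g (t (Suc i)) - g (t i)\<bar>)"
    by (simp add: sum_ennreal)
  also have "\<dots> \<le> total_variation g"
    unfolding total_variation_def
    by (rule SUP_upper2[of "(n, t)"]) (use n in \<open>auto simp: t_def divide_right_mono\<close>)
  also note V(1)
  finally have tv: "(\<Sum>i<n. \<bar>g (t (Suc i)) - g (t i)\<bar>) \<le> V"
    using V(2) by (simp add: ennreal_le_iff)
  have "\<bar>\<Sum>i<n. f (t i) * (g (t (Suc i)) - g (t i))\<bar> \<le> (\<Sum>i<n. B * \<bar>g (t (Suc i)) - g (t i)\<bar>)"
    by (intro order_trans[OF sum_abs] sum_mono) (auto simp: abs_mult intro!: mult_right_mono B t01)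
  also have "\<dots> \<le> B * V"
    using tv B0 by (auto simp: sum_distrib_left[symmetric] intro!: mult_left_mono)
  finally have "\<bar>\<Sum>i<n. f (t i) * (g (t (Suc i)) - g (t i))\<bar> \<le> B * V" .
  moreover have "\<bar>g 1 * f 1\<bar> \<le> \<bar>g 1\<bar> * B"
    by (auto simp: abs_mult intro!: mult_left_mono B)
  ultimately show ?thesis unfolding eq by (simp add: algebra_simps)
qed

section \<open>Continuity of the integral and its extension to the closed span\<close>

lemma rs_sum_limit_bound:
  assumes "rs_sum g f \<longlonglongrightarrow> I" "total_variation g \<le> ennreal V" "0 \<le> V"
    and "\<And>x. x \<in> unit_int \<Longrightarrow> \<bar>f x\<bar> \<le> B"
  shows "\<bar>I\<bar> \<le> (\<bar>g 1\<bar> + V) * B"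
proof (rule LIMSEQ_le_const2[OF tendsto_rabs[OF assms(1)]])
  show "\<exists>N. \<forall>n\<ge>N. \<bar>rs_sum g f n\<bar> \<le> (\<bar>g 1\<bar> + V) * B"
    using rs_sum_bound[OF assms(2-4)] by (auto intro!: exI[of _ 1])
qed

text \<open>Sup-norm continuity in the integrator, the basis for extending the integral to the
  closure.\<close>

lemma signed_integral_diff_le:
  assumes "f \<in> span_dist_funs" "h \<in> span_dist_funs" "continuous_on unit_int g"
    and "total_variation g \<le> ennreal V" "0 \<le> V"
    and "\<And>x. x \<in> unit_int \<Longrightarrow> \<bar>f x - h x\<bar> \<le> B"
  shows "\<bar>signed_integral g f - signed_integral g h\<bar> \<le> (\<bar>g 1\<bar> + V) * B"
proof (rule rs_sum_limit_bound[where f = "\<lambda>x. f x - h x"])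
  show "rs_sum g (\<lambda>x. f x - h x) \<longlonglongrightarrow> signed_integral g f - signed_integral g h"
    unfolding rs_sum_diff_right by (intro tendsto_diff rs_sum_tendsto_signed_integral assms)
qed (use assms in auto)

text \<open>For \<open>g = K y\<close> and \<open>k = K x\<close> the factor is controlled by
  \<open>kernel_zeta\<close> and \<open>kernel_var\<close>, uniformly over bounded \<open>f\<close>.
  This is the equicontinuity behind the compactness of the operator.\<close>

lemma signed_integral_diff_integrand_le:
  assumes "f \<in> span_dist_funs" "continuous_on unit_int g" "continuous_on unit_int k"
    and "total_variation (\<lambda>u. g u - k u) \<le> ennreal V" "0 \<le> V"
    and "\<And>x. x \<in> unit_int \<Longrightarrow> \<bar>f x\<bar> \<le> B"
  shows "\<bar>signed_integral g f - signed_integral k f\<bar> \<le> (\<bar>g 1 - k 1\<bar> + V) * B"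
proof (rule rs_sum_limit_bound)
  show "rs_sum (\<lambda>u. g u - k u) f \<longlonglongrightarrow> signed_integral g f - signed_integral k f"
    unfolding rs_sum_diff_left by (intro tendsto_diff rs_sum_tendsto_signed_integral assms)
qed (use assms in auto)

text \<open>Any two approximating sequences are eventually uniformly close, hence so are their
  integrals. Taking the two equal gives the Cauchy property, and taking them different gives
  independence of the choice.\<close>

lemma signed_integral_tendsto_ext_integral:
  assumes fs: "\<And>k. fs k \<in> span_dist_funs" and lim: "uniform_limit UNIV fs f sequentially"
    and g: "continuous_on unit_int g" and V: "total_variation g \<le> ennreal V" "0 \<le> V"
  shows "(\<lambda>k. signed_integral g (fs k)) \<longlonglongrightarrow> ext_integral g f"
proof -
  define C where "C = \<bar>g 1\<bar> + V"
  have "0 \<le> C" using V(2) by (simp add: C_def)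
  have small: "\<exists>N. \<forall>m\<ge>N. \<forall>n\<ge>N. \<bar>signed_integral g (hs m) - signed_integral g (hs' n)\<bar> < e"
    if hs: "\<And>k. hs k \<in> span_dist_funs" "uniform_limit UNIV hs f sequentially"
      "\<And>k. hs' k \<in> span_dist_funs" "uniform_limit UNIV hs' f sequentially" "0 < e" for hs hs' e
  proof -
    \<comment> \<open>Terms of the two sequences lie within \<open>2 * d\<close> of each other, and
      integration enlarges this by at most the factor \<open>C\<close>; \<open>C + 1\<close> gives a
      strict bound even for \<open>C = 0\<close>.\<close>
    define d where "d = e / (2 * (C + 1))"
    have "0 < d" using hs(5) \<open>0 \<le> C\<close> by (simp add: d_def)
    then have "\<forall>\<^sub>F n in sequentially. \<forall>x. dist (hs n x) (f x) < d"
      "\<forall>\<^sub>F n in sequentially. \<forall>x. dist (hs' n x) (f x) < d"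
      using uniform_limitD[OF hs(2)] uniform_limitD[OF hs(4)] by simp_all
    then obtain N where N: "\<And>n x. N \<le> n \<Longrightarrow> dist (hs n x) (f x) < d" "\<And>n x. N \<le> n \<Longrightarrow> dist (hs' n x) (f x) < d"
      using eventually_conj unfolding eventually_sequentially by (metis nle_le order_trans)
    have "\<bar>signed_integral g (hs m) - signed_integral g (hs' n)\<bar> < e" if mn: "N \<le> m" "N \<le> n" for m n
    proof -
      have "\<bar>hs m x - hs' n x\<bar> \<le> 2 * d" for x
        using N(1)[OF mn(1), of x] N(2)[OF mn(2), of x] by (simp add: dist_real_def abs_if split: if_splits)
      then have "\<bar>signed_integral g (hs m) - signed_integral g (hs' n)\<bar> \<le> C * (2 * d)"
        unfolding C_def by (intro signed_integral_diff_le hs(1,3) g V)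
      also have "\<dots> < (C + 1) * (2 * d)" using \<open>0 < d\<close> by simp
      also have "\<dots> = e" using \<open>0 \<le> C\<close> by (simp add: d_def field_simps)
      finally show ?thesis .
    qed
    then show ?thesis by blast
  qed
  show ?thesis
  proof (cases "f \<in> span_dist_funs")
    case True
    show ?thesis
    proof (rule LIMSEQ_I)
      fix e :: real assume "0 < e"
      \<comment> \<open>On the span, \<open>f\<close> approximates itself, so comparison with the
        constant sequence suffices.\<close>
      from small[OF fs lim, of "\<lambda>_. f", OF True uniform_limit_const this]
      show "\<exists>no. \<forall>n\<ge>no. norm (signed_integral g (fs n) - ext_integral g f) < e"
        using True by (auto simp: ext_integral_def)
    qed
  next
    case False
    have "Cauchy (\<lambda>k. signed_integral g (fs k))"
      using small[OF fs lim fs lim] by (auto simp: Cauchy_def dist_real_def)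
    then obtain L where L: "(\<lambda>k. signed_integral g (fs k)) \<longlonglongrightarrow> L"
      using Cauchy_convergent_iff convergent_def by blast
    have "ext_integral g f = L"
      unfolding ext_integral_def if_not_P[OF False]
    proof (rule the_equality)
      show "\<forall>hs. (\<forall>k. hs k \<in> span_dist_funs) \<and> uniform_limit UNIV hs f sequentially \<longrightarrow>
        (\<lambda>k. signed_integral g (hs k)) \<longlonglongrightarrow> L"
      proof safe
        fix hs assume hs: "\<forall>k. hs k \<in> span_dist_funs" "uniform_limit UNIV hs f sequentially"
        have "(\<lambda>k. signed_integral g (hs k) - signed_integral g (fs k)) \<longlonglongrightarrow> 0"
          by (rule LIMSEQ_I) (use small[OF spec[OF hs(1)] hs(2) fs lim] in fastforce)
        from tendsto_add[OF this L] show "(\<lambda>k. signed_integral g (hs k)) \<longlonglongrightarrow> L" by simp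
      qed
    \<comment> \<open>The given sequence \<open>fs\<close> keeps the quantification over
      approximating sequences from being vacuous, which pins down the limit.\<close>
    qed (use fs lim L LIMSEQ_unique in blast)
    with L show ?thesis by simp
  qed
qed

section \<open>Stability of the fixed-point equation\<close>

text \<open>The bound \<open>B\<close> is there only to make the real supremum meaningful; its size
  is irrelevant.\<close>

lemma abs_le_sup_norm:
  assumes "\<And>x. \<bar>f x\<bar> \<le> B"
  shows "\<bar>f x\<bar> \<le> sup_norm f"
  unfolding sup_norm_def using assms by (intro cSUP_upper bdd_aboveI2[of _ _ B]) auto

lemma sup_norm_le:
  assumes "\<And>x. \<bar>f x\<bar> \<le> B"
  shows "sup_norm f \<le> B"
  unfolding sup_norm_def using assms by (intro cSUP_least) auto

lemma dist_funs_sup_norm: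
  assumes "F \<in> dist_funs" "G \<in> dist_funs"
  shows "\<bar>F x - G x\<bar> \<le> sup_norm (\<lambda>x. F x - G x)"
proof (rule abs_le_sup_norm)
  show "\<bar>F x - G x\<bar> \<le> 1" for x
    using dist_funs_nonneg[OF assms(1), of x] dist_funs_le_1[OF assms(1), of x]
      dist_funs_nonneg[OF assms(2), of x] dist_funs_le_1[OF assms(2), of x] by simp
qed

lemma uniformly_bounded_variationE:
  assumes "uniformly_bounded_variation K"
  obtains V where "0 \<le> V" "\<And>x. x \<in> unit_int \<Longrightarrow> total_variation (K x) \<le> ennreal V"
proof -
  let ?S = "SUP x\<in>unit_int. total_variation (K x)"
  have "?S < \<infinity>" using assms by (simp add: uniformly_bounded_variation_def)
  then have "ennreal (enn2real ?S) = ?S" by (intro ennreal_enn2real) auto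
  then show thesis
    by (intro that[of "enn2real ?S"]) (auto intro: SUP_upper simp del: atLeastAtMost_iff)
qed

text \<open>The knots form the net: a point is matched with the left end of its cell, whose index is
  the largest one with \<open>s i \<le> x\<close>. At the last index the cell is
  \<open>{1}\<close>.\<close>

lemma cadlag_finite_net:
  assumes "cadlag_countable_jumps K" "0 < e"
  obtains P where "finite P" "P \<subseteq> unit_int"
    "\<And>x. x \<in> unit_int \<Longrightarrow> \<exists>y\<in>P. kernel_zeta K x y < e \<and> kernel_var K x y < ennreal e"
proof -
  obtain N :: nat and s where N: "1 \<le> N" and s: "s 1 = 0" "s N = 1" "strict_mono_on {1..N} s"
    and E: "\<And>i x1 x2. i \<in> {1..N} \<Longrightarrow> x1 \<in> (if i < N then {s i..<s (Suc i)} else {1}) \<Longrightarrow>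
      x2 \<in> (if i < N then {s i..<s (Suc i)} else {1}) \<Longrightarrow>
      kernel_zeta K x1 x2 < e \<and> kernel_var K x1 x2 < ennreal e"
    using assms unfolding cadlag_countable_jumps_def Let_def by metis
  have mono: "s i \<le> s j" if "i \<in> {1..N}" "j \<in> {1..N}" "i \<le> j" for i j
    using mono_onD[OF strict_mono_on_imp_mono_on[OF s(3)] that] .
  show thesis
  proof
    show "finite (s ` {1..N})" by simp
    show "s ` {1..N} \<subseteq> unit_int"
      using mono[of 1] mono[of _ N] s N by auto
    fix x assume x: "x \<in> unit_int"
    define A where "A = {i \<in> {1..N}. s i \<le> x}"
    define i where "i = Max A"
    have "finite A" "1 \<in> A" using x s(1) N by (auto simp: A_def)
    then have i: "i \<in> A" unfolding i_def by (intro Max_in) auto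
    have "x \<in> (if i < N then {s i..<s (Suc i)} else {1})"
    proof (cases "i < N")
      case True
      have "Suc i \<notin> A" using Max_ge[OF \<open>finite A\<close>, of "Suc i"] by (auto simp: i_def)
      with True i show ?thesis by (auto simp: A_def)
    next
      case False
      with i x s(2) show ?thesis by (auto simp: A_def)
    qed
    moreover have "s i \<in> (if i < N then {s i..<s (Suc i)} else {1})"
      using i s by (auto simp: A_def not_less intro: strict_mono_onD)
    ultimately show "\<exists>y\<in>s ` {1..N}. kernel_zeta K x y < e \<and> kernel_var K x y < ennreal e"
      using E[of i x "s i"] i by (auto simp: A_def)
  qed
qed

text \<open>A violation of the stability bound with constant \<open>C\<close> is divided by its sup
  norm \<open>t\<close>. Since \<open>C * d < t\<close>, the scaled residual is at most
  \<open>d / t\<close>, hence at most \<open>1 / C\<close>.\<close>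

lemma normalized_residual:
  assumes f: "f \<in> span_dist_funs" "f 1 = 0" and g: "\<And>x. x \<in> unit_int \<Longrightarrow> continuous_on unit_int (K x)"
    and res: "\<And>x. x \<in> unit_int \<Longrightarrow> \<bar>f x - signed_integral (K x) f\<bar> \<le> d"
    and x0: "C * d < \<bar>f x0\<bar>" and "0 < C"
  obtains h x where "h \<in> span_dist_funs" "h 1 = 0" "\<And>x. \<bar>h x\<bar> \<le> 1" "1 / 2 < \<bar>h x\<bar>"
    "\<And>x. x \<in> unit_int \<Longrightarrow> \<bar>h x - signed_integral (K x) h\<bar> \<le> 1 / C"
proof -
  obtain B where B: "\<And>x. \<bar>f x\<bar> \<le> B" using span_dist_funs_bounded[OF f(1)] by blast
  define t where "t = sup_norm f"
  have le: "\<bar>f x\<bar> \<le> t" for x unfolding t_def by (rule abs_le_sup_norm[OF B])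
  have "0 \<le> d" using order_trans[OF abs_ge_zero res[of 0]] by simp
  then have "0 \<le> C * d" using \<open>0 < C\<close> by simp
  have "C * d < t" using x0 le[of x0] by simp
  have "0 < t" using \<open>C * d < t\<close> \<open>0 \<le> C * d\<close> by simp
  \<comment> \<open>The supremum need not be attained, but half of it is exceeded somewhere because
    it is positive.\<close>
  have "\<exists>x. t / 2 < \<bar>f x\<bar>"
  proof (rule ccontr)
    assume "\<nexists>x. t / 2 < \<bar>f x\<bar>"
    then have "t \<le> t / 2" unfolding t_def by (intro sup_norm_le) (simp add: not_less)
    with \<open>0 < t\<close> show False by simp
  qed
  then obtain x where x: "t / 2 < \<bar>f x\<bar>" by blast
  show thesis
  proof
    show "(\<lambda>x. (1 / t) * f x) \<in> span_dist_funs" by (rule span_dist_funs_scale[OF f(1)])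
    show "(1 / t) * f 1 = 0" using f(2) by simp
    show "\<bar>(1 / t) * f x\<bar> \<le> 1" for x using le[of x] \<open>0 < t\<close> by (simp add: abs_mult)
    show "1 / 2 < \<bar>(1 / t) * f x\<bar>" using x \<open>0 < t\<close> by (simp add: abs_mult field_simps)
    fix y :: real assume y: "y \<in> unit_int"
    have "\<bar>(1 / t) * f y - signed_integral (K y) (\<lambda>x. (1 / t) * f x)\<bar> = (1 / t) * \<bar>f y - signed_integral (K y) f\<bar>"
      using \<open>0 < t\<close> unfolding signed_integral_scale[OF f(1) g[OF y]] right_diff_distrib[symmetric] abs_mult
      by simp
    also have "\<dots> \<le> (1 / t) * d" using res[OF y] \<open>0 < t\<close> by (intro mult_left_mono) auto
    also have "\<dots> \<le> 1 / C" using \<open>C * d < t\<close> \<open>0 < t\<close> \<open>0 < C\<close> by (simp add: field_simps)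
    finally show "\<bar>(1 / t) * f y - signed_integral (K y) (\<lambda>x. (1 / t) * f x)\<bar> \<le> 1 / C" .
  qed
qed

text \<open>
  The images of a bounded sequence under the operator are controlled, up to a small error, by
  their values on a finite net.  Hence a normalized sequence with vanishing residual has a
  uniformly convergent subsequence, whose limit would be a second fixed direction.
\<close>

lemma fixed_point_stability:
  assumes cont: "\<And>x. x \<in> unit_int \<Longrightarrow> continuous_on unit_int (K x)"
    and ubv: "uniformly_bounded_variation K" and cadlag: "cadlag_countable_jumps K"
    and unique: "unique_stationary K p"
  obtains C where "0 < C"
    "\<And>f d x. \<lbrakk>f \<in> span_dist_funs; f 1 = 0; \<And>x. x \<in> unit_int \<Longrightarrow> \<bar>f x - signed_integral (K x) f\<bar> \<le> d\<rbrakk>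
      \<Longrightarrow> \<bar>f x\<bar> \<le> C * d"
proof -
  \<comment> \<open>If no constant works, every \<open>Suc n\<close> fails, which yields normalized
    functions \<open>h n\<close> with residual at most \<open>1 / Suc n\<close>.\<close>
  have False if neg: "\<And>n. \<exists>f d x0. f \<in> span_dist_funs \<and> f 1 = 0 \<and>
      (\<forall>x\<in>unit_int. \<bar>f x - signed_integral (K x) f\<bar> \<le> d) \<and> real (Suc n) * d < \<bar>f x0\<bar>"
  proof -
    have "\<exists>h x. h \<in> span_dist_funs \<and> h 1 = 0 \<and> (\<forall>x. \<bar>h x\<bar> \<le> 1) \<and> 1 / 2 < \<bar>h x\<bar> \<and>
      (\<forall>x\<in>unit_int. \<bar>h x - signed_integral (K x) h\<bar> \<le> 1 / real (Suc n))" for n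
    proof -
      obtain f d x0 where f: "f \<in> span_dist_funs" "f 1 = 0"
        "\<And>x. x \<in> unit_int \<Longrightarrow> \<bar>f x - signed_integral (K x) f\<bar> \<le> d" "real (Suc n) * d < \<bar>f x0\<bar>"
        using neg[of n] by blast
      show ?thesis
        by (rule normalized_residual[OF f(1,2) cont f(3,4)]) auto
    qed
    then obtain h X where h: "\<And>n. h n \<in> span_dist_funs" "\<And>n. h n 1 = 0" "\<And>n x. \<bar>h n x\<bar> \<le> 1"
      "\<And>n. 1 / 2 < \<bar>h n (X n)\<bar>"
      and res: "\<And>n x. x \<in> unit_int \<Longrightarrow> \<bar>h n x - signed_integral (K x) (h n)\<bar> \<le> 1 / real (Suc n)"
      by metis
    define T where "T n x = signed_integral (K x) (h n)" for n x
    \<comment> \<open>Beyond 1 the functions keep the value \<open>h n 1 = 0\<close>, so uniform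
      convergence only has to be checked on the unit interval.\<close>
    have off: "h n x = 0" if "x \<notin> unit_int" for n x
      using that h(2)[of n] span_dist_funs_below[OF h(1), of x n] span_dist_funs_above[OF h(1), of x n]
      by (cases "x < 0") auto
    \<comment> \<open>The net is the same for all \<open>n\<close>. One \<open>e\<close> comes from
      the difference at 1 and the other from the variation.\<close>
    have "\<exists>P. finite P \<and> P \<subseteq> unit_int \<and>
        (\<forall>x\<in>unit_int. \<exists>y\<in>P. \<forall>n. \<bar>T n x - T n y\<bar> \<le> 2 * e)" if "0 < e" for e
    proof -
      obtain P where P: "finite P" "P \<subseteq> unit_int"
        "\<And>x. x \<in> unit_int \<Longrightarrow> \<exists>y\<in>P. kernel_zeta K x y < e \<and> kernel_var K x y < ennreal e"
        using cadlag_finite_net[OF cadlag \<open>0 < e\<close>] by blast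
      have "\<bar>T n x - T n y\<bar> \<le> 2 * e"
        if "x \<in> unit_int" "y \<in> P" "kernel_zeta K x y < e" "kernel_var K x y < ennreal e" for n x y
      proof -
        have "\<bar>T n y - T n x\<bar> \<le> (\<bar>K y 1 - K x 1\<bar> + e) * 1"
          unfolding T_def using that P(2) \<open>0 < e\<close> h
          by (intro signed_integral_diff_integrand_le cont) (auto simp: kernel_var_def)
        with that(3) show ?thesis by (simp add: kernel_zeta_def)
      qed
      with P show ?thesis by (meson)
    qed
    then obtain P where P: "\<And>e. 0 < e \<Longrightarrow> finite (P e)" "\<And>e. 0 < e \<Longrightarrow> P e \<subseteq> unit_int"
      "\<And>e x. \<lbrakk>0 < e; x \<in> unit_int\<rbrakk> \<Longrightarrow> \<exists>y\<in>P e. \<forall>n. \<bar>T n x - T n y\<bar> \<le> 2 * e"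
      by metis
    \<comment> \<open>Collecting the nets for all accuracies \<open>1 / Suc k\<close> keeps the set
      countable, so a diagonal subsequence converges on every net at once.\<close>
    define D where "D = (\<Union>k::nat. P (1 / real (Suc k)))"
    have "countable D" unfolding D_def by (intro countable_UN) (simp_all add: countable_finite P(1))
    have bound: "norm (T n x) \<le> 2" if "x \<in> D" for n x
    proof -
      from that obtain j where "x \<in> P (1 / real (Suc j))" by (auto simp: D_def)
      with P(2)[of "1 / real (Suc j)"] have "x \<in> unit_int" by auto
      from res[OF this, of n] have "\<bar>h n x - T n x\<bar> \<le> 1"
        unfolding T_def by (rule order_trans) simp
      with h(3)[of n x] show ?thesis by simp
    qed
    obtain k where k: "strict_mono k" "\<And>x. x \<in> D \<Longrightarrow> \<exists>l. (\<lambda>n. T (k n) x) \<longlonglongrightarrow> l"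
      using function_convergent_subsequence[where f = T, OF \<open>countable D\<close> bound] by blast
    have "\<exists>N. \<forall>m n x. N \<le> m \<and> N \<le> n \<and> True \<longrightarrow> dist (h (k m) x) (h (k n) x) < e" if "0 < e" for e
    proof -
      \<comment> \<open>Error budget: two passages from \<open>h\<close> to \<open>T\<close> cost
        \<open>e / 8\<close> each, two passages to a net point \<open>e / 4\<close> each, and the
        comparison at the net point \<open>e / 8\<close>, in total less than
        \<open>e\<close>.\<close>
      obtain j where j: "1 / real (Suc j) < e / 8"
        using \<open>0 < e\<close> nat_approx_posE[of "e / 8"] by auto
      let ?P = "P (1 / real (Suc j))"
      have "\<forall>y\<in>?P. \<exists>N. \<forall>m\<ge>N. \<forall>n\<ge>N. \<bar>T (k m) y - T (k n) y\<bar> < e / 8"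
      proof
        fix y assume "y \<in> ?P"
        then have "y \<in> D" by (auto simp: D_def)
        then have "Cauchy (\<lambda>n. T (k n) y)"
          using k(2) Cauchy_convergent_iff convergent_def by blast
        from CauchyD[OF this, of "e / 8"] \<open>0 < e\<close>
        show "\<exists>N. \<forall>m\<ge>N. \<forall>n\<ge>N. \<bar>T (k m) y - T (k n) y\<bar> < e / 8" by simp
      qed
      then obtain M where M: "\<And>y m n. \<lbrakk>y \<in> ?P; M y \<le> m; M y \<le> n\<rbrakk> \<Longrightarrow> \<bar>T (k m) y - T (k n) y\<bar> < e / 8"
        by metis
      have fin: "finite ?P" by (rule P(1)) simp
      \<comment> \<open>Including \<open>j\<close> makes the residuals small as well, because
        \<open>k i \<ge> i \<ge> j\<close> from there on.\<close>
      define N where "N = Max (insert j (M ` ?P))"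
      have N: "j \<le> N" "\<And>y. y \<in> ?P \<Longrightarrow> M y \<le> N" using fin by (auto simp: N_def)
      have "\<bar>h (k m) x - h (k n) x\<bar> < e" if mn: "N \<le> m" "N \<le> n" for m n x
      proof (cases "x \<in> unit_int")
        case True
        obtain y where y: "y \<in> ?P" "\<And>n. \<bar>T n x - T n y\<bar> \<le> 2 * (1 / real (Suc j))"
          using P(3)[OF _ True, of "1 / real (Suc j)"] by auto
        have close: "\<bar>h (k i) x - T (k i) x\<bar> < e / 8" if "N \<le> i" for i
        proof -
          have "Suc j \<le> Suc (k i)" using that N(1) seq_suble[OF k(1), of i] by simp
          then have "1 / real (Suc (k i)) \<le> 1 / real (Suc j)" by (intro frac_le) auto
          with res[OF True, of "k i"] j show ?thesis by (simp add: T_def)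
        qed
        have "\<bar>T (k m) y - T (k n) y\<bar> < e / 8"
          using mn N(2)[OF y(1)] by (intro M[OF y(1)]) auto
        with close[OF mn(1)] close[OF mn(2)] y(2)[of "k m"] y(2)[of "k n"] j
        show ?thesis by linarith
      next
        case False
        then show ?thesis using off \<open>0 < e\<close> by simp
      qed
      then show ?thesis by (auto simp: dist_real_def)
    qed
    then obtain f where f: "\<And>e. 0 < e \<Longrightarrow> \<exists>N. \<forall>n x. N \<le> n \<and> True \<longrightarrow> dist (h (k n) x) (f x) < e"
      using uniformly_convergent_eq_cauchy[of "\<lambda>_. True" "\<lambda>n. h (k n)"] by blast
    then have lim: "uniform_limit UNIV (\<lambda>n. h (k n)) f sequentially"
      unfolding uniform_limit_sequentially_iff by simp
    then have limx: "(\<lambda>n. h (k n) x) \<longlonglongrightarrow> f x" for x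
      by (rule tendsto_uniform_limitI) simp
    have "f \<in> closure_span"
      unfolding closure_span_def
      by (intro CollectI exI[of _ "\<lambda>n. h (k n)"] conjI allI h(1) lim)
    obtain V where V: "0 \<le> V" "\<And>x. x \<in> unit_int \<Longrightarrow> total_variation (K x) \<le> ennreal V"
      using uniformly_bounded_variationE[OF ubv] by blast
    \<comment> \<open>The integrals along the subsequence tend to \<open>f x\<close> because the
      residuals vanish, and to the extended integral by uniform convergence.\<close>
    have fixed: "f x = ext_integral (K x) f" if x: "x \<in> unit_int" for x
    proof (rule LIMSEQ_unique)
      have "(\<lambda>n. signed_integral (K x) (h n) - h n x) \<longlonglongrightarrow> 0"
        by (rule Lim_null_comparison[OF _ LIMSEQ_inverse_real_of_nat])
          (use res[OF x] in \<open>simp add: abs_minus_commute inverse_eq_divide\<close>)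
      from LIMSEQ_subseq_LIMSEQ[OF this k(1)]
      have "(\<lambda>n. signed_integral (K x) (h (k n)) - h (k n) x) \<longlonglongrightarrow> 0" by (simp add: o_def)
      from tendsto_add[OF this limx[of x]]
      show "(\<lambda>n. signed_integral (K x) (h (k n))) \<longlonglongrightarrow> f x" by simp
      show "(\<lambda>n. signed_integral (K x) (h (k n))) \<longlonglongrightarrow> ext_integral (K x) f"
        by (rule signed_integral_tendsto_ext_integral[OF h(1) lim cont[OF x] V(2)[OF x] V(1)])
    qed
    have "f \<in> {f \<in> closure_span. \<forall>x\<in>unit_int. f x = ext_integral (K x) f}"
      using \<open>f \<in> closure_span\<close> fixed by simp
    then have "f \<in> {(\<lambda>x. \<alpha> * p x) | \<alpha>. True}"
      using unique by (simp only: unique_stationary_def)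
    then obtain \<alpha> where \<alpha>: "f = (\<lambda>x. \<alpha> * p x)" by auto
    \<comment> \<open>Normalization at 1 forces the multiple of \<open>p\<close> to be zero, while
      every \<open>h n\<close> exceeds 1/2 in absolute value somewhere; uniform convergence excludes
      this.\<close>
    have "f 1 = 0" using limx[of 1] h(2) LIMSEQ_unique[OF _ tendsto_const] by simp
    moreover have "p 1 = 1"
      using unique by (auto simp: unique_stationary_def stationary_def dist_funs_above)
    ultimately have "f = (\<lambda>x. 0)" using \<alpha> by simp
    with f[of "1 / 2"] obtain N where "\<And>x. \<bar>h (k N) x\<bar> < 1 / 2" by auto
    from this[of "X (k N)"] h(4)[of "k N"] show False by simp
  qed
  then obtain n where "\<And>f d x0. \<lbrakk>f \<in> span_dist_funs; f 1 = 0;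
      \<forall>x\<in>unit_int. \<bar>f x - signed_integral (K x) f\<bar> \<le> d\<rbrakk> \<Longrightarrow> \<bar>f x0\<bar> \<le> real (Suc n) * d"
    by (meson not_less)
  then show thesis by (intro that[of "real (Suc n)"]) auto
qed

section \<open>The truncated chain is nearly stationary\<close>

text \<open>Let \<open>c m\<close> be the largest state not above \<open>x\<close>. Stationarity and
  telescoping rows give \<open>F x\<close> as the average of \<open>K (c m) (c i)\<close> with
  weights \<open>w i\<close>; the integral is the same average of \<open>K x (c i)\<close>. Only the
  first argument differs, by at most the mesh.\<close>

lemma chain_residual:
  assumes chain: "finite_chain J c Q" and stat: "chain_stationary J c Q F"
    and Q: "\<And>i j. \<lbrakk>i \<in> {1..J}; j \<in> {1..J}\<rbrakk> \<Longrightarrow>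
      Q i j = ext_kernel K (ext_state J c j) (c i) - ext_kernel K (ext_state J c (j - 1)) (c i)"
    and cont: "\<And>x. x \<in> unit_int \<Longrightarrow> continuous_on unit_int (K x)"
    and lip: "\<And>x y u. \<lbrakk>x \<in> unit_int; y \<in> unit_int; u \<in> unit_int\<rbrakk> \<Longrightarrow> \<bar>K x u - K y u\<bar> \<le> L * \<bar>x - y\<bar>"
    and "0 \<le> L" and mesh: "\<And>i. i \<in> {2..J} \<Longrightarrow> \<bar>c i - c (i - 1)\<bar> \<le> d" and "0 \<le> d"
    and x: "x \<in> unit_int"
  shows "\<bar>F x - signed_integral (K x) F\<bar> \<le> L * d"
proof -
  have J: "1 \<le> J" and c: "c 1 = 0" "c J = 1" "strict_mono_on {1..J} c"
    using chain by (auto simp: finite_chain_def)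
  have mono: "c i \<le> c j" if "i \<in> {1..J}" "j \<in> {1..J}" "i \<le> j" for i j
    using mono_onD[OF strict_mono_on_imp_mono_on[OF c(3)] that] .
  have c01: "c i \<in> unit_int" if "i \<in> {1..J}" for i
    using mono[of 1 i] mono[of i J] that c J by auto
  obtain w where w: "\<And>i. i \<in> {1..J} \<Longrightarrow> 0 \<le> w i" "(\<Sum>i=1..J. w i) = 1"
      "\<And>j. j \<in> {1..J} \<Longrightarrow> w j = (\<Sum>i=1..J. w i * Q i j)"
    and F: "F \<in> dist_funs" "F = (\<lambda>x. \<Sum>j=1..J. of_bool (c j \<le> x) * w j)"
    using stat unfolding chain_stationary_def by blast
  define A where "A = {i \<in> {1..J}. c i \<le> x}"
  define m where "m = Max A"
  have "finite A" "1 \<in> A" using x c(1) J by (auto simp: A_def)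
  then have "m \<in> A" unfolding m_def by (intro Max_in) auto
  then have m: "m \<in> {1..J}" "c m \<le> x" by (auto simp: A_def)
  have le: "c j \<le> x \<longleftrightarrow> j \<le> m" if "j \<in> {1..J}" for j
    using that Max_ge[OF \<open>finite A\<close>, of j] mono[OF that m(1)] m(2) by (auto simp: A_def m_def)
  \<comment> \<open>At the last state \<open>x\<close> must equal 1; otherwise \<open>x\<close> lies
    strictly below the next state.\<close>
  have close: "\<bar>c m - x\<bar> \<le> d"
  proof (cases "m = J")
    case True
    with m(2) x c(2) \<open>0 \<le> d\<close> show ?thesis by simp
  next
    case False
    with m(1) have "Suc m \<in> {2..J}" by auto
    with le[of "Suc m"] m(2) mesh[of "Suc m"] show ?thesis by auto
  qed
  \<comment> \<open>The convention that the kernel vanishes at \<open>-\<infinity>\<close> makes the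
    first column \<open>K (c 1) (c i)\<close>, so the sum telescopes without remainder.\<close>
  have tele: "(\<Sum>j=1..l. Q i j) = K (c l) (c i)" if i: "i \<in> {1..J}" and "1 \<le> l" "l \<le> J" for i l
    using that(2,3)
  proof (induction l rule: nat_induct_at_least)
    case base
    then show ?case using Q[OF i, of 1] by (simp add: ext_kernel_def ext_state_def)
  next
    case (Suc l)
    then show ?case using Q[OF i, of "Suc l"] by (simp add: ext_kernel_def ext_state_def)
  qed
  have "F x = (\<Sum>j=1..J. \<Sum>i=1..J. w i * (of_bool (c j \<le> x) * Q i j))"
    unfolding F(2)
  proof (intro sum.cong refl)
    fix j assume "j \<in> {1..J}"
    then have "of_bool (c j \<le> x) * w j = of_bool (c j \<le> x) * (\<Sum>i=1..J. w i * Q i j)"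
      by (simp only: w(3)[symmetric])
    then show "of_bool (c j \<le> x) * w j = (\<Sum>i=1..J. w i * (of_bool (c j \<le> x) * Q i j))"
      by (simp only: sum_distrib_left mult.left_commute)
  qed
  also have "\<dots> = (\<Sum>i=1..J. w i * (\<Sum>j=1..J. of_bool (c j \<le> x) * Q i j))"
    unfolding sum_distrib_left by (rule sum.swap)
  also have "\<dots> = (\<Sum>i=1..J. w i * K (c m) (c i))"
  proof (intro sum.cong refl arg_cong2[where f = "(*)"])
    fix i assume i: "i \<in> {1..J}"
    have "(\<Sum>j=1..J. of_bool (c j \<le> x) * Q i j) = (\<Sum>j=1..m. Q i j)"
      by (rule sum.mono_neutral_cong_right) (use m(1) le in auto)
    with tele[OF i] m(1) show "(\<Sum>j=1..J. of_bool (c j \<le> x) * Q i j) = K (c m) (c i)" by simp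
  qed
  finally have Fx: "F x = (\<Sum>i=1..J. w i * K (c m) (c i))" .
  have "signed_integral (K x) F = (\<Sum>i=1..J. w i * K x (c i))"
    by (rule signed_integral_discrete[OF cont[OF x] _ _ F(2) dist_funs_subset_span[OF F(1)]])
      (use c01 in auto)
  then have "\<bar>F x - signed_integral (K x) F\<bar> = \<bar>\<Sum>i=1..J. w i * (K (c m) (c i) - K x (c i))\<bar>"
    by (simp add: Fx sum_subtractf right_diff_distrib)
  also have "\<dots> \<le> (\<Sum>i=1..J. w i * (L * d))"
  proof (intro order_trans[OF sum_abs] sum_mono)
    fix i assume i: "i \<in> {1..J}"
    have "\<bar>K (c m) (c i) - K x (c i)\<bar> \<le> L * \<bar>c m - x\<bar>" by (rule lip[OF c01[OF m(1)] x c01[OF i]])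
    also have "\<dots> \<le> L * d" using close \<open>0 \<le> L\<close> by (rule mult_left_mono)
    finally show "\<bar>w i * (K (c m) (c i) - K x (c i))\<bar> \<le> w i * (L * d)"
      using w(1)[OF i] by (simp add: abs_mult mult_left_mono)
  qed
  also have "\<dots> = L * d" using w(2) by (simp only: sum_distrib_right[symmetric] mult_1)
  finally show ?thesis .
qed

section \<open>Approximation by discrete distributions\<close>

text \<open>
  By pigeonhole, one of \<open>n + 1\<close> intervals on which \<open>p\<close> grows by the same amount carries no mass
  of a measure with \<open>n\<close> atoms.
\<close>

lemma discrete_dist_distance:
  assumes disc: "discrete_dist n F" and p: "p \<in> dist_funs"
    and ab: "a \<le> b" "continuous_on {a..b} p" "p a < p b"
  shows "(p b - p a) / (2 * real (Suc n)) \<le> sup_norm (\<lambda>x. F x - p x)"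
proof -
  obtain M S where M: "real_distribution M" "concentrated_on_unit M" "F = cdf M"
    and S: "finite S" "card S = n" "measure M S = 1"
    using disc by (auto simp: discrete_dist_def)
  interpret real_distribution M by fact
  have F: "F \<in> dist_funs" using M by (auto simp: dist_funs_def)
  define t where "t = (p b - p a) / real (Suc n)"
  have "0 < t" using ab(3) by (simp add: t_def)
  have tn: "t * real (Suc n) = p b - p a" by (simp add: t_def)
  \<comment> \<open>The intermediate value theorem provides points at equally spaced levels of
    \<open>p\<close>; their order follows from monotonicity of \<open>p\<close> alone.\<close>
  have "\<exists>y. p y = p a + t * real k" if "k \<le> Suc n" for k
  proof -
    have "t * real k \<le> t * real (Suc n)" using that \<open>0 < t\<close> by (intro mult_left_mono) auto
    then have "p a + t * real k \<le> p b" unfolding tn by simp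
    then show ?thesis
      using IVT'[of p a "p a + t * real k" b] ab(1,2) \<open>0 < t\<close> by auto
  qed
  then obtain y where y: "\<And>k. k \<le> Suc n \<Longrightarrow> p (y k) = p a + t * real k" by metis
  have less: "y k < y l" if "k < l" "l \<le> Suc n" for k l
  proof (rule ccontr)
    assume "\<not> y k < y l"
    then have "p (y l) \<le> p (y k)" by (intro dist_funs_mono[OF p]) simp
    with y[of k] y[of l] that \<open>0 < t\<close> show False by simp
  qed
  have "\<exists>k\<le>n. S \<inter> {y k<..y (Suc k)} = {}"
  proof (rule ccontr)
    assume "\<not> ?thesis"
    then have "\<forall>k\<in>{..n}. \<exists>s. s \<in> S \<and> y k < s \<and> s \<le> y (Suc k)" by fastforce
    then obtain s where s: "\<And>k. k \<le> n \<Longrightarrow> s k \<in> S \<and> y k < s k \<and> s k \<le> y (Suc k)"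
      by (metis atMost_iff)
    \<comment> \<open>The intervals are half-open and consecutive, so the chosen support points are
      distinct: \<open>n + 1\<close> of them in a set of size \<open>n\<close>.\<close>
    have "s k < s l" if "k < l" "l \<le> n" for k l
    proof -
      have "y (Suc k) \<le> y l" using that less[of "Suc k" l] by (cases "Suc k = l") auto
      with s[of k] s[of l] that show ?thesis by fastforce
    qed
    then have "inj_on s {..n}" by (intro linorder_inj_onI) (auto simp: less_le)
    then have "card {..n} \<le> card S" using s S(1) by (intro card_inj_on_le) auto
    with S(2) show False by simp
  qed
  then obtain k where k: "k \<le> n" "S \<inter> {y k<..y (Suc k)} = {}" by blast
  have "S \<in> sets M" using S(1) by (simp add: finite_imp_closed borel_closed)
  have "measure M {y k<..y (Suc k)} \<le> measure M (space M - S)"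
    using k(2) \<open>S \<in> sets M\<close> by (intro finite_measure_mono) auto
  also have "\<dots> = 0" using S(3) \<open>S \<in> sets M\<close> by (subst prob_compl) auto
  finally have "F (y (Suc k)) = F (y k)"
    using cdf_diff_eq[OF less[of k "Suc k"]] k(1) M(3) measure_nonneg[of M "{y k<..y (Suc k)}"] by simp
  moreover have "p (y (Suc k)) - p (y k) = t" using y k(1) by (simp add: algebra_simps)
  \<comment> \<open>\<open>F\<close> stays constant while \<open>p\<close> grows by
    \<open>t\<close>, so at one of the two endpoints they differ by at least half of that.\<close>
  ultimately have "t / 2 \<le> sup_norm (\<lambda>x. F x - p x)"
    using dist_funs_sup_norm[OF F p, of "y k"] dist_funs_sup_norm[OF F p, of "y (Suc k)"] by linarith
  then show ?thesis by (simp add: t_def field_simps)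
qed

section \<open>Comparison of the two rates\<close>

theorem theorem4:
  fixes K :: "real \<Rightarrow> real \<Rightarrow> real" and p :: "real \<Rightarrow> real"
    and J :: "nat \<Rightarrow> nat" and c :: "nat \<Rightarrow> nat \<Rightarrow> real" and Q :: "nat \<Rightarrow> nat \<Rightarrow> nat \<Rightarrow> real"
    and pr :: "nat \<Rightarrow> real \<Rightarrow> real"
    and Jhat :: "nat \<Rightarrow> nat" and phat :: "nat \<Rightarrow> real \<Rightarrow> real"
    and x1 x2 :: real
  assumes kernel: "markov_kernel K"
    and ubv: "uniformly_bounded_variation K"
    and cadlag: "cadlag_countable_jumps K"
    and unique: "unique_stationary K p"
    and chain: "\<And>r. finite_chain (J r) (c r) (Q r)"
    and chain_stat: "\<And>r. chain_stationary (J r) (c r) (Q r) (pr r)"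
    and trunc: "proper_truncation K J c Q"
    and dense: "unit_int \<subseteq> closure (\<Union>r. c r ` {1..J r})"
    and mesh: "(\<lambda>r. Max ((\<lambda>i. \<bar>c r i - c r (i - 1)\<bar>) ` {2..J r})) \<in> O(\<lambda>r. 1 / real (J r))"
    and lipschitz: "\<exists>L. L-lipschitz_on (unit_int \<times> unit_int) (\<lambda>(x, u). K x u)"
    and interval: "x1 < x2" "{x1..x2} \<subseteq> unit_int"
    and p_cont: "continuous_on {x1..x2} p"
    and p_strict: "strict_mono_on {x1..x2} p"
    and discrete: "\<And>r. discrete_dist (Jhat r) (phat r)"
    and jumps: "(\<lambda>r. real (Jhat r) / real (J r)) \<longlonglongrightarrow> 1"
  shows "(\<lambda>r. sup_norm (\<lambda>x. pr r x - p x)) \<in> O(\<lambda>r. sup_norm (\<lambda>x. phat r x - p x))"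
proof -
  have p: "p \<in> dist_funs" "\<And>x. x \<in> unit_int \<Longrightarrow> p x = signed_integral (K x) p"
    using unique dist_funs_subset_span
    by (auto simp: unique_stationary_def stationary_def ext_integral_def)
  obtain L where "L-lipschitz_on (unit_int \<times> unit_int) (\<lambda>(x, u). K x u)" using lipschitz by blast
  then have "0 \<le> L" and L: "\<And>x y u v. \<lbrakk>x \<in> unit_int; y \<in> unit_int; u \<in> unit_int; v \<in> unit_int\<rbrakk> \<Longrightarrow>
      \<bar>K x u - K y v\<bar> \<le> L * dist (x, u) (y, v)"
    by (auto simp: lipschitz_on_def dist_real_def)
  have lip: "\<bar>K x u - K y u\<bar> \<le> L * \<bar>x - y\<bar>" if "x \<in> unit_int" "y \<in> unit_int" "u \<in> unit_int" for x y u
    using L[OF that(1,2,3,3)] by (simp add: dist_Pair_Pair dist_real_def)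
  have cont: "continuous_on unit_int (K x)" if "x \<in> unit_int" for x
  proof (rule lipschitz_on_continuous_on)
    show "L-lipschitz_on unit_int (K x)"
      using L[OF that that] \<open>0 \<le> L\<close> by (auto simp: lipschitz_on_def dist_Pair_Pair dist_real_def)
  qed
  obtain C where "0 < C" and C: "\<And>f d x. \<lbrakk>f \<in> span_dist_funs; f 1 = 0;
      \<And>x. x \<in> unit_int \<Longrightarrow> \<bar>f x - signed_integral (K x) f\<bar> \<le> d\<rbrakk> \<Longrightarrow> \<bar>f x\<bar> \<le> C * d"
    by (rule fixed_point_stability[OF cont ubv cadlag unique]) blast+
  define h where "h r = Max ((\<lambda>i. \<bar>c r i - c r (i - 1)\<bar>) ` {2..J r})" for r
  \<comment> \<open>The states include both 0 and 1, hence the maximum defining the mesh runs over a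
    nonempty set.\<close>
  have J: "2 \<le> J r" for r
  proof (rule ccontr)
    assume "\<not> 2 \<le> J r"
    with chain[of r] have "J r = 1" by (simp add: finite_chain_def)
    with chain[of r] show False by (auto simp: finite_chain_def)
  qed
  have h: "\<bar>c r i - c r (i - 1)\<bar> \<le> h r" if "i \<in> {2..J r}" for r i
    unfolding h_def using that by (intro Max_ge) auto
  have h0: "0 \<le> h r" for r using order_trans[OF abs_ge_zero h[of 2 r]] J[of r] by simp
  have upper: "sup_norm (\<lambda>x. pr r x - p x) \<le> C * (L * h r)" for r
  proof (rule sup_norm_le, rule C[where f = "\<lambda>x. pr r x - p x"])
    have pr: "pr r \<in> dist_funs" using chain_stat[of r] by (simp add: chain_stationary_def)
    show "(\<lambda>x. pr r x - p x) \<in> span_dist_funs" by (rule span_dist_funs_diff[OF pr p(1)])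
    show "pr r 1 - p 1 = 0" by (simp add: dist_funs_above[OF pr] dist_funs_above[OF p(1)])
    fix x :: real assume x: "x \<in> unit_int"
    have "\<bar>pr r x - signed_integral (K x) (pr r)\<bar> \<le> L * h r"
    proof (rule chain_residual[OF chain chain_stat _ cont lip \<open>0 \<le> L\<close> h h0 x])
      show "Q r i j = ext_kernel K (ext_state (J r) (c r) j) (c r i) -
          ext_kernel K (ext_state (J r) (c r) (j - 1)) (c r i)"
        if "i \<in> {1..J r}" "j \<in> {1..J r}" for i j
        using trunc that unfolding proper_truncation_def by blast
    qed
    \<comment> \<open>Since \<open>p\<close> has residual zero, subtracting it leaves the residual
      of \<open>pr r\<close> unchanged.\<close>
    then show "\<bar>pr r x - p x - signed_integral (K x) (\<lambda>x. pr r x - p x)\<bar> \<le> L * h r"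
      using p(2)[OF x] by (simp add: signed_integral_diff[OF pr p(1) cont[OF x]])
  qed
  define \<Delta> where "\<Delta> = p x2 - p x1"
  have "0 < \<Delta>" using strict_mono_onD[OF p_strict, of x1 x2] interval(1) by (simp add: \<Delta>_def)
  have "\<forall>\<^sub>F r in sequentially. real (Jhat r) / real (J r) < 2"
    using jumps by (rule order_tendstoD) simp
  \<comment> \<open>Eventually \<open>Jhat r < 2 * J r\<close>, so \<open>Jhat r + 1\<close> is at
    most \<open>3 * J r\<close>; with the factor 2 of the lower bound this gives the constant
    6.\<close>
  then have lower: "\<forall>\<^sub>F r in sequentially. 1 / real (J r) \<le> 6 / \<Delta> * sup_norm (\<lambda>x. phat r x - p x)"
  proof eventually_elim
    case (elim r)
    have "real (Suc (Jhat r)) \<le> 3 * real (J r)" using elim J[of r] by (simp add: field_simps)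
    then have "\<Delta> / (2 * (3 * real (J r))) \<le> \<Delta> / (2 * real (Suc (Jhat r)))"
      using \<open>0 < \<Delta>\<close> by (intro divide_left_mono mult_left_mono) auto
    also have "\<dots> \<le> sup_norm (\<lambda>x. phat r x - p x)"
      unfolding \<Delta>_def using \<open>0 < \<Delta>\<close> interval
      by (intro discrete_dist_distance discrete p(1) p_cont) (auto simp: \<Delta>_def)
    finally show ?case using \<open>0 < \<Delta>\<close> J[of r] by (simp add: field_simps)
  qed
  have "(\<lambda>r. sup_norm (\<lambda>x. pr r x - p x)) \<in> O(h)"
  proof (rule bigoI)
    show "\<forall>\<^sub>F r in sequentially. norm (sup_norm (\<lambda>x. pr r x - p x)) \<le> (C * L) * norm (h r)"
    proof (rule always_eventually, rule allI)
      fix r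
      have pr: "pr r \<in> dist_funs" using chain_stat[of r] by (simp add: chain_stationary_def)
      have "0 \<le> sup_norm (\<lambda>x. pr r x - p x)"
        using order_trans[OF abs_ge_zero dist_funs_sup_norm[OF pr p(1)]] .
      with upper[of r] h0[of r]
      show "norm (sup_norm (\<lambda>x. pr r x - p x)) \<le> (C * L) * norm (h r)" by (simp add: mult.assoc)
    qed
  qed
  also have "h \<in> O(\<lambda>r. 1 / real (J r))" using mesh unfolding h_def .
  also have "(\<lambda>r. 1 / real (J r)) \<in> O(\<lambda>r. sup_norm (\<lambda>x. phat r x - p x))"
  proof (rule bigoI)
    show "\<forall>\<^sub>F r in sequentially. norm (1 / real (J r)) \<le> 6 / \<Delta> * norm (sup_norm (\<lambda>x. phat r x - p x))"
      using lower
    proof eventually_elim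
      case (elim r)
      also have "6 / \<Delta> * sup_norm (\<lambda>x. phat r x - p x) \<le> 6 / \<Delta> * norm (sup_norm (\<lambda>x. phat r x - p x))"
        using \<open>0 < \<Delta>\<close> by (intro mult_left_mono) auto
      finally show ?case by simp
    qed
  qed
  finally show ?thesis .
qed

end
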